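(* Let $(M,J,g)$ and $(M,J,\tilde g)$ be quasi-Kähler manifolds with Norden metric, where $\tilde g(X,Y)=g(X,JY)$ is the metric associated with $g$. Then the following two (equivalent) identities hold for all $x,y,z$: $$\tilde F(x,y,z)=-F(Jx,y,z),$$ $$(\tilde\nabla_xJ)y=-(\nabla_{Jx}J)Jy.$$
   Context: An almost complex manifold with Norden metric $(M,J,g)$ is a smooth $2n$-dimensional manifold with a $(1,1)$-tensor field $J$ and a pseudo-Riemannian metric $g$ such that $J^2X=-X$ and $g(JX,JY)=-g(X,Y)$ for all vector fields $X,Y$ ($g$ is then necessarily of signature $(n,n)$). The associated metric $\tilde g(X,Y)=g(X,JY)$ is then also a Norden metric. Let $\nabla$, $\tilde\nabla$ be the Levi-Civita connections of $g$, $\tilde g$, and set $F(X,Y,Z)=g((\nabla_XJ)Y,Z)$ and $\tilde F(X,Y,Z)=\tilde g((\tilde\nabla_XJ)Y,Z)$. The manifold $(M,J,g)$ is called quasi-Kähler with Norden metric (class $\mathcal W_3$) if $F(X,Y,Z)+F(Y,Z,X)+F(Z,X,Y)=0$ for all $X,Y,Z$; likewise $(M,J,\tilde g)$ is quasi-Kähler with Norden metric if the cyclic sum of $\tilde F$ vanishes. *)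

theory Defs
  imports "HOL-Analysis.Analysis"
begin

section \<open>Smooth maps between Euclidean spaces\<close>

fun Ck_on :: "nat \<Rightarrow> 'a::euclidean_space set \<Rightarrow> ('a \<Rightarrow> 'b::real_normed_vector) \<Rightarrow> bool" where
  "Ck_on 0 S f \<longleftrightarrow> continuous_on S f"
| "Ck_on (Suc k) S f \<longleftrightarrow> (\<forall>x\<in>S. f differentiable (at x)) \<and>
     (\<forall>v. Ck_on k S (\<lambda>x. frechet_derivative f (at x) v))"

text \<open>Only meant for open \<open>S\<close>, because derivatives are taken in full neighbourhoods.\<close>

definition smooth_on :: "'a::euclidean_space set \<Rightarrow> ('a \<Rightarrow> 'b::real_normed_vector) \<Rightarrow> bool" where
  "smooth_on S f \<longleftrightarrow> (\<forall>k. Ck_on k S f)"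

section \<open>Smooth manifolds\<close>

text \<open>The underlying space of the manifold is the whole type \<open>'m\<close>, whose classes make it
  Hausdorff and second countable; its dimension is \<open>DIM('e)\<close>.  A chart is a pair
  \<open>(U, \<phi>)\<close>; the values of \<open>\<phi>\<close> outside \<open>U\<close> are irrelevant.\<close>

type_synonym ('m, 'e) chart = "'m set \<times> ('m \<Rightarrow> 'e)"

definition is_chart :: "('m::topological_space, 'e::euclidean_space) chart \<Rightarrow> bool" where
  "is_chart = (\<lambda>(U, \<phi>). open U \<and> open (\<phi> ` U) \<and> homeomorphism U (\<phi> ` U) \<phi> (inv_into U \<phi>))"

definition smooth_atlas ::
  "('m::{t2_space, second_countable_topology}, 'e::euclidean_space) chart set \<Rightarrow> bool" where
  "smooth_atlas A \<longleftrightarrow>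
     (\<forall>c\<in>A. is_chart c) \<and> (\<Union>(U, \<phi>)\<in>A. U) = UNIV \<and>
     (\<forall>(U, \<phi>)\<in>A. \<forall>(V, \<psi>)\<in>A. smooth_on (\<phi> ` (U \<inter> V)) (\<psi> \<circ> inv_into U \<phi>))"

definition smooth_functions ::
  "('m::{t2_space, second_countable_topology}, 'e::euclidean_space) chart set \<Rightarrow> ('m \<Rightarrow> real) set" where
  "smooth_functions A = {f. \<forall>(U, \<phi>)\<in>A. smooth_on (\<phi> ` U) (f \<circ> inv_into U \<phi>)}"

text \<open>Tangent vectors at \<open>p\<close> are the derivations at \<open>p\<close> of the algebra of smooth functions.
  Setting them to \<open>0\<close> on non-smooth functions makes HOL equality agree with equality of
  derivations.\<close>

type_synonym 'm tvec = "('m \<Rightarrow> real) \<Rightarrow> real"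

definition tangent_space ::
  "('m::{t2_space, second_countable_topology}, 'e::euclidean_space) chart set \<Rightarrow> 'm \<Rightarrow> 'm tvec set" where
  "tangent_space A p = {v.
     (\<forall>f. f \<notin> smooth_functions A \<longrightarrow> v f = 0) \<and>
     (\<forall>f\<in>smooth_functions A. \<forall>h\<in>smooth_functions A. \<forall>a b.
        v (\<lambda>q. a * f q + b * h q) = a * v f + b * v h) \<and>
     (\<forall>f\<in>smooth_functions A. \<forall>h\<in>smooth_functions A.
        v (\<lambda>q. f q * h q) = f p * v h + h p * v f)}"

type_synonym 'm vfield = "'m \<Rightarrow> 'm tvec"

definition vector_fields ::
  "('m::{t2_space, second_countable_topology}, 'e::euclidean_space) chart set \<Rightarrow> 'm vfield set" where
  "vector_fields A = {X. (\<forall>p. X p \<in> tangent_space A p) \<and>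
     (\<forall>f\<in>smooth_functions A. (\<lambda>p. X p f) \<in> smooth_functions A)}"

definition lie_bracket :: "'m vfield \<Rightarrow> 'm vfield \<Rightarrow> 'm vfield" where
  "lie_bracket X Y = (\<lambda>p f. X p (\<lambda>q. Y q f) - Y p (\<lambda>q. X q f))"

section \<open>Tensor fields and connections\<close>

text \<open>Tensor fields are given pointwise; only their values on \<open>tangent_space A p\<close> matter.\<close>

definition pseudo_riemannian_metric ::
  "('m::{t2_space, second_countable_topology}, 'e::euclidean_space) chart set
     \<Rightarrow> ('m \<Rightarrow> 'm tvec \<Rightarrow> 'm tvec \<Rightarrow> real) \<Rightarrow> bool" where
  "pseudo_riemannian_metric A g \<longleftrightarrow>
     (\<forall>p. \<forall>u\<in>tangent_space A p. \<forall>v\<in>tangent_space A p. g p u v = g p v u) \<and>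
     (\<forall>p. \<forall>u\<in>tangent_space A p. \<forall>v\<in>tangent_space A p. \<forall>w\<in>tangent_space A p. \<forall>a b.
        g p (\<lambda>f. a * u f + b * v f) w = a * g p u w + b * g p v w) \<and>
     (\<forall>p. \<forall>u\<in>tangent_space A p. (\<forall>v\<in>tangent_space A p. g p u v = 0) \<longrightarrow> u = (\<lambda>f. 0)) \<and>
     (\<forall>X\<in>vector_fields A. \<forall>Y\<in>vector_fields A. (\<lambda>p. g p (X p) (Y p)) \<in> smooth_functions A)"

definition tensor_field_1_1 ::
  "('m::{t2_space, second_countable_topology}, 'e::euclidean_space) chart set
     \<Rightarrow> ('m \<Rightarrow> 'm tvec \<Rightarrow> 'm tvec) \<Rightarrow> bool" where
  "tensor_field_1_1 A J \<longleftrightarrow>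
     (\<forall>p. \<forall>u\<in>tangent_space A p. J p u \<in> tangent_space A p) \<and>
     (\<forall>p. \<forall>u\<in>tangent_space A p. \<forall>v\<in>tangent_space A p. \<forall>a b.
        J p (\<lambda>f. a * u f + b * v f) = (\<lambda>f. a * J p u f + b * J p v f)) \<and>
     (\<forall>X\<in>vector_fields A. (\<lambda>p. J p (X p)) \<in> vector_fields A)"

definition affine_connection ::
  "('m::{t2_space, second_countable_topology}, 'e::euclidean_space) chart set
     \<Rightarrow> ('m vfield \<Rightarrow> 'm vfield \<Rightarrow> 'm vfield) \<Rightarrow> bool" where
  "affine_connection A D \<longleftrightarrow>
     (\<forall>X\<in>vector_fields A. \<forall>Y\<in>vector_fields A. D X Y \<in> vector_fields A) \<and>
     (\<forall>X\<in>vector_fields A. \<forall>Y\<in>vector_fields A. \<forall>Z\<in>vector_fields A.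
        \<forall>a\<in>smooth_functions A. \<forall>b\<in>smooth_functions A.
        D (\<lambda>p f. a p * X p f + b p * Y p f) Z = (\<lambda>p f. a p * D X Z p f + b p * D Y Z p f)) \<and>
     (\<forall>X\<in>vector_fields A. \<forall>Y\<in>vector_fields A. \<forall>Z\<in>vector_fields A.
        D X (\<lambda>p f. Y p f + Z p f) = (\<lambda>p f. D X Y p f + D X Z p f)) \<and>
     (\<forall>X\<in>vector_fields A. \<forall>Y\<in>vector_fields A. \<forall>a\<in>smooth_functions A.
        D X (\<lambda>p f. a p * Y p f) = (\<lambda>p f. X p a * Y p f + a p * D X Y p f))"

definition levi_civita ::
  "('m::{t2_space, second_countable_topology}, 'e::euclidean_space) chart set
     \<Rightarrow> ('m \<Rightarrow> 'm tvec \<Rightarrow> 'm tvec \<Rightarrow> real) \<Rightarrow> ('m vfield \<Rightarrow> 'm vfield \<Rightarrow> 'm vfield) \<Rightarrow> bool" where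
  "levi_civita A g D \<longleftrightarrow> affine_connection A D \<and>
     (\<forall>X\<in>vector_fields A. \<forall>Y\<in>vector_fields A.
        (\<lambda>p f. D X Y p f - D Y X p f) = lie_bracket X Y) \<and>
     (\<forall>X\<in>vector_fields A. \<forall>Y\<in>vector_fields A. \<forall>Z\<in>vector_fields A. \<forall>p.
        X p (\<lambda>q. g q (Y q) (Z q)) = g p (D X Y p) (Z p) + g p (Y p) (D X Z p))"

text \<open>\<open>appJ J X\<close> is the vector field \<open>JX\<close>, and \<open>nablaJ D J X Y\<close> is
  \<open>(\<nabla>\<^sub>X J) Y = \<nabla>\<^sub>X (JY) - J (\<nabla>\<^sub>X Y)\<close>.\<close>

definition appJ :: "('m \<Rightarrow> 'm tvec \<Rightarrow> 'm tvec) \<Rightarrow> 'm vfield \<Rightarrow> 'm vfield" where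
  "appJ J X = (\<lambda>p. J p (X p))"

definition nablaJ :: "('m vfield \<Rightarrow> 'm vfield \<Rightarrow> 'm vfield) \<Rightarrow> ('m \<Rightarrow> 'm tvec \<Rightarrow> 'm tvec)
    \<Rightarrow> 'm vfield \<Rightarrow> 'm vfield \<Rightarrow> 'm vfield" where
  "nablaJ D J X Y = (\<lambda>p f. D X (appJ J Y) p f - appJ J (D X Y) p f)"

definition F_tensor :: "('m vfield \<Rightarrow> 'm vfield \<Rightarrow> 'm vfield) \<Rightarrow> ('m \<Rightarrow> 'm tvec \<Rightarrow> 'm tvec)
    \<Rightarrow> ('m \<Rightarrow> 'm tvec \<Rightarrow> 'm tvec \<Rightarrow> real) \<Rightarrow> 'm vfield \<Rightarrow> 'm vfield \<Rightarrow> 'm vfield \<Rightarrow> 'm \<Rightarrow> real" where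
  "F_tensor D J g X Y Z = (\<lambda>p. g p (nablaJ D J X Y p) (Z p))"

section \<open>Norden metrics\<close>

definition almost_complex_norden ::
  "('m::{t2_space, second_countable_topology}, 'e::euclidean_space) chart set
     \<Rightarrow> ('m \<Rightarrow> 'm tvec \<Rightarrow> 'm tvec) \<Rightarrow> ('m \<Rightarrow> 'm tvec \<Rightarrow> 'm tvec \<Rightarrow> real) \<Rightarrow> bool" where
  "almost_complex_norden A J g \<longleftrightarrow>
     smooth_atlas A \<and> even DIM('e) \<and> tensor_field_1_1 A J \<and> pseudo_riemannian_metric A g \<and>
     (\<forall>X\<in>vector_fields A. appJ J (appJ J X) = (\<lambda>p f. - X p f)) \<and>
     (\<forall>X\<in>vector_fields A. \<forall>Y\<in>vector_fields A. \<forall>p.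
        g p (appJ J X p) (appJ J Y p) = - g p (X p) (Y p))"

definition associated_metric :: "('m \<Rightarrow> 'm tvec \<Rightarrow> 'm tvec)
    \<Rightarrow> ('m \<Rightarrow> 'm tvec \<Rightarrow> 'm tvec \<Rightarrow> real) \<Rightarrow> 'm \<Rightarrow> 'm tvec \<Rightarrow> 'm tvec \<Rightarrow> real" where
  "associated_metric J g = (\<lambda>p u v. g p u (J p v))"

text \<open>The Levi-Civita connection \<open>D\<close> of \<open>g\<close>, which exists and is unique on vector fields, is
  carried along as an argument.\<close>

definition quasi_kaehler_norden ::
  "('m::{t2_space, second_countable_topology}, 'e::euclidean_space) chart set
     \<Rightarrow> ('m \<Rightarrow> 'm tvec \<Rightarrow> 'm tvec) \<Rightarrow> ('m \<Rightarrow> 'm tvec \<Rightarrow> 'm tvec \<Rightarrow> real)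
     \<Rightarrow> ('m vfield \<Rightarrow> 'm vfield \<Rightarrow> 'm vfield) \<Rightarrow> bool" where
  "quasi_kaehler_norden A J g D \<longleftrightarrow>
     almost_complex_norden A J g \<and> levi_civita A g D \<and>
     (\<forall>X\<in>vector_fields A. \<forall>Y\<in>vector_fields A. \<forall>Z\<in>vector_fields A. \<forall>p.
        F_tensor D J g X Y Z p + F_tensor D J g Y Z X p + F_tensor D J g Z X Y p = 0)"

end

theory Submission imports Defs begin

text \<open>Let \<open>\<Phi> = \<nabla>~ - \<nabla>\<close>, a symmetric difference of torsion-free connections.  Comparing metric
  compatibility of \<open>g\<close> and \<open>g~\<close> gives \<open>g~(\<Phi>(X,Y),Z) + g~(\<Phi>(X,Z),Y) = F(X,Y,Z)\<close>, so the Koszul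
  trick together with the vanishing cyclic sum of \<open>F\<close> yields \<open>g~(\<Phi>(X,Y),Z) = -F(Z,X,Y)\<close>.
  Substituting into \<open>F~(X,Y,Z) = F(X,Y,JZ) + g~(\<Phi>(X,JY),Z) - g~(\<Phi>(X,Y),JZ)\<close> and using the cyclic
  sum twice gives the first identity.  The second follows by nondegeneracy, which speaks about tangent
  vectors at a point; these have to be extended to global vector fields, by a bump function and
  Hadamard's lemma.\<close>

section \<open>Calculus of smooth maps\<close>

lemma Ck_on_subset: "Ck_on k T f \<Longrightarrow> S \<subseteq> T \<Longrightarrow> Ck_on k S f"
proof (induction k arbitrary: f)
  case 0
  then show ?case by (simp add: continuous_on_subset)
next
  case (Suc k)
  then show ?case by (simp add: subset_iff)
qed

lemma Ck_on_lower: "Ck_on (Suc k) S f \<Longrightarrow> Ck_on k S f"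
proof (induction k arbitrary: f)
  case 0
  then show ?case
    by (auto intro!: continuous_at_imp_continuous_on differentiable_imp_continuous_within)
next
  case (Suc k)
  then have "Ck_on (Suc k) S (\<lambda>x. frechet_derivative f (at x) v)" for v
    using Ck_on.simps(2)[of "Suc k" S f] by blast
  with Suc show ?case by simp
qed

lemma Ck_on_imp_continuous_on: "Ck_on k S f \<Longrightarrow> continuous_on S f"
  by (induction k) (use Ck_on_lower in auto)

text \<open>Around each point of the open set the two maps agree on a neighbourhood, so their
  derivatives agree on \<open>S\<close> as well and the induction can pass to the directional
  derivatives.\<close>

lemma Ck_on_cong:
  assumes "Ck_on k S f" "open S" "\<And>x. x \<in> S \<Longrightarrow> f x = h x"
  shows "Ck_on k S h"
  using assms
proof (induction k arbitrary: f h)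
  case 0
  then show ?case using continuous_on_cong by (metis Ck_on.simps(1))
next
  case (Suc k)
  have d: "(h has_derivative frechet_derivative f (at x)) (at x)" if "x \<in> S" for x
    using Suc.prems that
    by (metis Ck_on.simps(2) frechet_derivative_works has_derivative_transform_within_open)
  then have eq: "frechet_derivative f (at x) v = frechet_derivative h (at x) v" if "x \<in> S" for x v
    using frechet_derivative_at that by metis
  have f: "Ck_on k S (\<lambda>x. frechet_derivative f (at x) v)" for v
    using Suc.prems(1) by simp
  have "Ck_on k S (\<lambda>x. frechet_derivative h (at x) v)" for v
    by (rule Suc.IH[OF f[of v] Suc.prems(2) eq])
  moreover have "\<forall>x\<in>S. h differentiable (at x)"
    using d differentiableI by blast
  ultimately show ?case by simp
qed

text \<open>Allows any explicit formula for the derivative in place of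
  \<open>frechet_derivative\<close>, which is only a choice operator; uniqueness of derivatives
  identifies the two.\<close>

lemma Ck_on_SucI:
  assumes "open S" "\<And>x. x \<in> S \<Longrightarrow> (f has_derivative f' x) (at x)"
    and "\<And>v. Ck_on k S (\<lambda>x. f' x v)"
  shows "Ck_on (Suc k) S f"
proof -
  have "Ck_on k S (\<lambda>x. frechet_derivative f (at x) v)" for v
    by (rule Ck_on_cong[OF assms(3)[of v] assms(1)]) (use assms(2) frechet_derivative_at in metis)
  with assms(2) show ?thesis by (auto simp: differentiable_def)
qed

lemma Ck_on_has_derivative:
  "Ck_on (Suc k) S f \<Longrightarrow> x \<in> S \<Longrightarrow> (f has_derivative frechet_derivative f (at x)) (at x)"
  using frechet_derivative_works by auto

text \<open>Derivatives are taken in full neighbourhoods, so every clause of \<open>Ck_on\<close>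
  can be checked near one point at a time. This is the gluing principle behind the later extensions
  by zero.\<close>

lemma Ck_on_local:
  assumes "\<And>x. x \<in> S \<Longrightarrow> \<exists>T. open T \<and> x \<in> T \<and> Ck_on k T f"
  shows "Ck_on k S f"
  using assms
proof (induction k arbitrary: f)
  case 0
  then show ?case
    by (auto intro!: continuous_at_imp_continuous_on) (metis continuous_on_eq_continuous_at)
next
  case (Suc k)
  then have "\<forall>x\<in>S. f differentiable (at x)" by (metis Ck_on.simps(2))
  moreover have "Ck_on k S (\<lambda>x. frechet_derivative f (at x) v)" for v
    by (rule Suc.IH) (use Suc.prems in \<open>metis Ck_on.simps(2)\<close>)
  ultimately show ?case by simp
qed

lemma Ck_on_const: "Ck_on k S (\<lambda>x. c)"
  by (induction k arbitrary: c) auto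

lemma Ck_on_linear:
  assumes "bounded_linear f" "open S"
  shows "Ck_on k S f"
proof (cases k)
  case 0
  then show ?thesis using assms by (simp add: linear_continuous_on)
next
  case (Suc m)
  then show ?thesis
    using assms by (auto intro!: Ck_on_SucI[where f' = "\<lambda>x. f"] Ck_on_const
        bounded_linear_imp_has_derivative simp del: Ck_on.simps)
qed

lemma Ck_on_add:
  assumes "Ck_on k S f" "Ck_on k S h" "open S"
  shows "Ck_on k S (\<lambda>x. f x + h x)"
  using assms
proof (induction k arbitrary: f h)
  case 0
  then show ?case by (simp add: continuous_on_add)
next
  case (Suc k)
  show ?case
    by (rule Ck_on_SucI[where f' = "\<lambda>x v. frechet_derivative f (at x) v + frechet_derivative h (at x) v"])
      (use Suc in \<open>auto intro!: has_derivative_add Suc.IH intro: Ck_on_has_derivative simp del: Ck_on.simps\<close>,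
       (use Suc in auto)+)
qed

text \<open>Covers multiplication, scaling and the inner product at once. By the product rule a
  directional derivative is a sum of two products of \<open>k\<close> times differentiable maps, to
  which the induction hypothesis applies.\<close>

lemma (in bounded_bilinear) Ck_on_prod:
  assumes "Ck_on k S f" "Ck_on k S h" "open S"
  shows "Ck_on k S (\<lambda>x. prod (f x) (h x))"
  using assms
proof (induction k arbitrary: f h)
  case 0
  then show ?case by (simp add: continuous_on)
next
  case (Suc k)
  show ?case
  proof (rule Ck_on_SucI[where f' = "\<lambda>x v. prod (f x) (frechet_derivative h (at x) v) + prod (frechet_derivative f (at x) v) (h x)"])
    show "((\<lambda>x. prod (f x) (h x)) has_derivative
        (\<lambda>v. prod (f x) (frechet_derivative h (at x) v) + prod (frechet_derivative f (at x) v) (h x))) (at x)"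
      if "x \<in> S" for x
      using Suc.prems that by (intro FDERIV Ck_on_has_derivative[of k S])
    show "Ck_on k S (\<lambda>x. prod (f x) (frechet_derivative h (at x) v) + prod (frechet_derivative f (at x) v) (h x))" for v
      by (intro Ck_on_add Suc.IH)
        (use Suc.prems Ck_on_lower[OF Suc.prems(1)] Ck_on_lower[OF Suc.prems(2)] in auto)
  qed (fact Suc.prems)
qed

lemma Ck_on_sum:
  assumes "\<And>i. i \<in> I \<Longrightarrow> Ck_on k S (f i)" "open S"
  shows "Ck_on k S (\<lambda>x. \<Sum>i\<in>I. f i x)"
  using assms
  by (induction I rule: infinite_finite_induct) (simp_all add: Ck_on_const Ck_on_add)

lemma Ck_on_compose:
  fixes f :: "'b::euclidean_space \<Rightarrow> 'c::real_normed_vector" and h :: "'a::euclidean_space \<Rightarrow> 'b"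
  assumes "Ck_on k T f" "Ck_on k S h" "open S" "h ` S \<subseteq> T"
  shows "Ck_on k S (\<lambda>x. f (h x))"
  using assms
proof (induction k arbitrary: f)
  case 0
  then show ?case using continuous_on_compose2 by (metis Ck_on.simps(1))
next
  case (Suc k)
  let ?f = "\<lambda>y. frechet_derivative f (at y)" and ?h = "\<lambda>x. frechet_derivative h (at x)"
  show ?case
  \<comment> \<open>In the chain rule the direction at which the outer derivative is evaluated
    varies with \<open>x\<close>, whereas \<open>Ck_on\<close> controls derivatives along fixed
    vectors only. Expanding in \<open>Basis\<close> makes the directions constant and moves the
    dependence on \<open>x\<close> into scalar coefficients.\<close>
  proof (rule Ck_on_SucI[where f' = "\<lambda>x v. \<Sum>b\<in>Basis. (?h x v \<bullet> b) *\<^sub>R ?f (h x) b"])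
    fix x assume x: "x \<in> S"
    have f: "(f has_derivative ?f (h x)) (at (h x))" and h: "(h has_derivative ?h x) (at x)"
      using Ck_on_has_derivative Suc.prems x by (blast, blast)
    interpret f: bounded_linear "?f (h x)" using f has_derivative_bounded_linear by blast
    have "?f (h x) (?h x v) = (\<Sum>b\<in>Basis. (?h x v \<bullet> b) *\<^sub>R ?f (h x) b)" for v
      by (metis (no_types, lifting) euclidean_representation f.scaleR f.sum sum.cong)
    then show "((\<lambda>x. f (h x)) has_derivative (\<lambda>v. \<Sum>b\<in>Basis. (?h x v \<bullet> b) *\<^sub>R ?f (h x) b)) (at x)"
      using has_derivative_compose[OF h f] by simp
  next
    fix v
    have 1: "Ck_on k S (\<lambda>x. ?f (h x) b)" for b
      using Suc.prems Ck_on_lower by (intro Suc.IH) (simp, blast+)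
    have 2: "Ck_on k S (\<lambda>x. ?h x v \<bullet> b)" for b
      using Suc.prems by (intro bounded_bilinear.Ck_on_prod[OF bounded_bilinear_inner] Ck_on_const) auto
    show "Ck_on k S (\<lambda>x. \<Sum>b\<in>Basis. (?h x v \<bullet> b) *\<^sub>R ?f (h x) b)"
      using 1 2 Suc.prems by (intro Ck_on_sum bounded_bilinear.Ck_on_prod[OF bounded_bilinear_scaleR])
  qed (fact Suc.prems)
qed

lemma smooth_on_subset: "smooth_on T f \<Longrightarrow> S \<subseteq> T \<Longrightarrow> smooth_on S f"
  unfolding smooth_on_def using Ck_on_subset by blast

lemma smooth_on_cong:
  "smooth_on S f \<Longrightarrow> open S \<Longrightarrow> (\<And>x. x \<in> S \<Longrightarrow> f x = h x) \<Longrightarrow> smooth_on S h"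
  unfolding smooth_on_def using Ck_on_cong by blast

lemma smooth_on_local:
  "(\<And>x. x \<in> S \<Longrightarrow> \<exists>T. open T \<and> x \<in> T \<and> smooth_on T f) \<Longrightarrow> smooth_on S f"
  unfolding smooth_on_def using Ck_on_local by metis

lemma smooth_on_const: "smooth_on S (\<lambda>x. c)"
  by (simp add: smooth_on_def Ck_on_const)

lemma smooth_on_linear: "bounded_linear f \<Longrightarrow> open S \<Longrightarrow> smooth_on S f"
  by (simp add: smooth_on_def Ck_on_linear)

lemma smooth_on_add: "smooth_on S f \<Longrightarrow> smooth_on S h \<Longrightarrow> open S \<Longrightarrow> smooth_on S (\<lambda>x. f x + h x)"
  by (simp add: smooth_on_def Ck_on_add)

lemma (in bounded_bilinear) smooth_on_prod:
  "smooth_on S f \<Longrightarrow> smooth_on S h \<Longrightarrow> open S \<Longrightarrow> smooth_on S (\<lambda>x. prod (f x) (h x))"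
  by (simp add: smooth_on_def Ck_on_prod)

lemmas smooth_on_mult = bounded_bilinear.smooth_on_prod[OF bounded_bilinear_mult]
lemmas smooth_on_inner = bounded_bilinear.smooth_on_prod[OF bounded_bilinear_inner]

lemma smooth_on_compose:
  fixes f :: "'b::euclidean_space \<Rightarrow> 'c::real_normed_vector" and h :: "'a::euclidean_space \<Rightarrow> 'b"
  shows "smooth_on T f \<Longrightarrow> smooth_on S h \<Longrightarrow> open S \<Longrightarrow> h ` S \<subseteq> T \<Longrightarrow> smooth_on S (\<lambda>x. f (h x))"
  unfolding smooth_on_def using Ck_on_compose by blast

lemma smooth_on_has_derivative:
  "smooth_on S f \<Longrightarrow> x \<in> S \<Longrightarrow> (f has_derivative frechet_derivative f (at x)) (at x)"
  unfolding smooth_on_def using Ck_on_has_derivative by blast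

lemma smooth_on_frechet_derivative:
  "smooth_on S f \<Longrightarrow> smooth_on S (\<lambda>x. frechet_derivative f (at x) v)"
  unfolding smooth_on_def by (metis Ck_on.simps(2))

section \<open>Bump functions and Hadamard's lemma\<close>

text \<open>\<open>flat 0\<close> is the classical function exp(-1/t), extended by 0. The powers of
  1/t are included because differentiation then stays within linear combinations of the
  family.\<close>

definition flat :: "nat \<Rightarrow> real \<Rightarrow> real" where
  "flat n t = (if t > 0 then inverse t ^ n / exp (inverse t) else 0)"

text \<open>From the right, substitute s = 1/t: the exponential beats every power of s at infinity.
  From the left the function is 0.\<close>

lemma flat_tendsto_0: "(flat n \<longlongrightarrow> 0) (at 0)"
proof (rule filterlim_split_at)
  show "(flat n \<longlongrightarrow> 0) (at_left 0)"
    by (rule tendsto_eventually) (auto simp: eventually_at_filter flat_def)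
  have "((\<lambda>t::real. inverse t ^ n / exp (inverse t)) \<longlongrightarrow> 0) (at_right 0)"
    using filterlim_compose[OF tendsto_power_div_exp_0 filterlim_inverse_at_top_right] .
  then show "(flat n \<longlongrightarrow> 0) (at_right 0)"
    by (rule Lim_transform_eventually) (auto simp: eventually_at_filter flat_def)
qed

lemma flat_has_real_derivative:
  "(flat n has_real_derivative flat (n + 2) t - n * flat (n + 1) t) (at t)"
proof -
  consider "t < 0" | "t = 0" | "t > 0" by linarith
  then show ?thesis
  proof cases
    case 1
    have "((\<lambda>t. 0) has_real_derivative 0) (at t)" by simp
    then have "(flat n has_real_derivative 0) (at t)"
      by (rule has_field_derivative_transform_within_open[of _ _ _ "{..<0}"]) (use 1 in \<open>auto simp: flat_def\<close>)
    then show ?thesis using 1 by (simp add: flat_def)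
  next
    case 2
    \<comment> \<open>The difference quotient of \<open>flat n\<close> at 0 is exactly
      \<open>flat (n + 1)\<close>, whose limit is already known.\<close>
    have "((\<lambda>y. (flat n y - flat n 0) / (y - 0)) \<longlongrightarrow> 0) (at 0)"
      by (rule Lim_transform_eventually[OF flat_tendsto_0[of "n + 1"]])
        (auto simp: eventually_at_filter flat_def field_simps)
    then show ?thesis using 2 by (simp add: has_field_derivative_iff flat_def)
  next
    case 3
    have "((\<lambda>t. inverse t ^ n / exp (inverse t)) has_real_derivative
        inverse t ^ (n + 2) / exp (inverse t) - n * (inverse t ^ (n + 1) / exp (inverse t))) (at t)"
    proof -
      have 1: "((\<lambda>t. inverse t ^ n) has_real_derivative - (n * inverse t ^ (n + 1))) (at t)"
      proof (cases n)
        case (Suc m)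
        then show ?thesis
          using DERIV_power_Suc[OF DERIV_inverse, of t m UNIV] 3 by (simp add: algebra_simps)
      qed simp
      have 2: "((\<lambda>t. inverse (exp (inverse t))) has_real_derivative
          inverse (exp (inverse t)) * inverse t ^ 2) (at t)"
        using 3 by (auto intro!: derivative_eq_intros simp: field_simps power2_eq_square)
      show ?thesis
        using DERIV_mult[OF 1 2] by (simp add: divide_inverse algebra_simps power_add power2_eq_square)
    qed
    then have "(flat n has_real_derivative
        inverse t ^ (n + 2) / exp (inverse t) - n * (inverse t ^ (n + 1) / exp (inverse t))) (at t)"
      by (rule has_field_derivative_transform_within_open[of _ _ _ "{0<..}"]) (use 3 in \<open>auto simp: flat_def\<close>)
    then show ?thesis using 3 by (simp add: flat_def)
  qed
qed

lemma smooth_on_flat: "smooth_on UNIV (flat n)"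
proof -
  have "Ck_on k UNIV (flat n)" for k
  proof (induction k arbitrary: n)
    case 0
    show ?case
      by (metis Ck_on.simps(1) DERIV_isCont continuous_at_imp_continuous_on flat_has_real_derivative)
  next
    case (Suc k)
    have "Ck_on k UNIV (\<lambda>t. (flat (n + 2) t + - real n * flat (n + 1) t) * v)" for v
      by (intro bounded_bilinear.Ck_on_prod[OF bounded_bilinear_mult] Ck_on_add Ck_on_const Suc) auto
    moreover have "(flat n has_derivative (*) (flat (n + 2) t + - real n * flat (n + 1) t)) (at t)" for t
      using flat_has_real_derivative[of n t] by (simp add: has_field_derivative_def)
    ultimately show ?case by (intro Ck_on_SucI) auto
  qed
  then show ?thesis by (simp add: smooth_on_def)
qed

lemma smooth_bump:
  fixes x0 :: "'a::euclidean_space"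
  assumes "r > 0"
  obtains \<beta> :: "'a \<Rightarrow> real" where "smooth_on UNIV \<beta>" "\<beta> x0 = 1" "\<And>x. x \<notin> cball x0 r \<Longrightarrow> \<beta> x = 0"
proof
  \<comment> \<open>The argument r^2 - |x - x0|^2 of \<open>flat 0\<close> is positive exactly on
    the open ball of radius \<open>r\<close>; dividing by the value at the centre normalises.
    Differences are spelled as sums with negatives so that the closure rules for
    \<open>smooth_on\<close> match syntactically.\<close>
  let ?\<beta> = "\<lambda>x. inverse (flat 0 (r * r)) * flat 0 (r * r + (-1) * ((x + - x0) \<bullet> (x + - x0)))"
  show "smooth_on UNIV ?\<beta>"
    by (intro smooth_on_mult smooth_on_const smooth_on_compose[OF smooth_on_flat] smooth_on_add
        smooth_on_inner smooth_on_linear bounded_linear_ident) auto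
  show "?\<beta> x0 = 1" using assms by (simp add: flat_def)
  show "?\<beta> x = 0" if "x \<notin> cball x0 r" for x
  proof -
    have "r < norm (x - x0)" using that by (simp add: dist_norm norm_minus_commute)
    then have "r * r < (x - x0) \<bullet> (x - x0)"
      using assms by (simp add: mult_strict_mono' dot_square_norm power2_eq_square)
    then show ?thesis by (simp add: flat_def)
  qed
qed

text \<open>Differentiating under the integral along \<open>v\<close> replaces \<open>u\<close> by
  its derivative along \<open>v\<close> and yields one more factor \<open>t\<close> from the inner
  map. With the weight \<open>t ^ m\<close> the class of integrals is therefore closed under
  differentiation, and the induction must run over all \<open>u\<close> and
  \<open>m\<close>.\<close>

lemma Ck_on_radial_integral:
  fixes u :: "'a::euclidean_space \<Rightarrow> real"
  assumes "Ck_on k (ball x0 R) u"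
  shows "Ck_on k (ball x0 R) (\<lambda>x. integral (cbox 0 1) (\<lambda>t. t ^ m * u (x0 + t *\<^sub>R (x - x0))))"
  using assms
proof (induction k arbitrary: u m)
  have in_ball: "x0 + t *\<^sub>R (x - x0) \<in> ball x0 R" if "x \<in> ball x0 R" "t \<in> cbox 0 (1::real)" for x t
  proof -
    have "t * norm (x - x0) \<le> 1 * norm (x - x0)" using that by (intro mult_right_mono) auto
    with that show ?thesis by (simp add: dist_norm norm_minus_commute)
  qed
  have cont: "continuous_on (ball x0 R \<times> cbox 0 1) (\<lambda>z. snd z ^ m * u (x0 + snd z *\<^sub>R (fst z - x0)))"
    if "Ck_on k (ball x0 R) u" for u :: "'a \<Rightarrow> real" and k m
    by (intro continuous_intros continuous_on_compose2[OF Ck_on_imp_continuous_on[OF that]])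
      (auto intro!: in_ball simp del: mem_ball)
  {
    case 0
    from cont[OF 0, of m] show ?case
      by (simp add: case_prod_unfold integral_continuous_on_param del: cbox_interval box_real)
  next
    case (Suc k)
    let ?d = "\<lambda>x t. frechet_derivative u (at (x0 + t *\<^sub>R (x - x0)))"
    \<comment> \<open>The Leibniz rule for integrals wants an operator-valued derivative that is
      jointly continuous, hence \<open>Blinfun\<close>; in finite dimension its continuity is
      checked on vectors one by one.\<close>
    let ?D = "\<lambda>x t. Blinfun (\<lambda>v. t ^ Suc m * ?d x t v)"
    have du: "(u has_derivative ?d x t) (at (x0 + t *\<^sub>R (x - x0)))"
      if "x \<in> ball x0 R" "t \<in> cbox 0 1" for x t
      using Ck_on_has_derivative[OF Suc.prems in_ball[OF that]] .
    have D: "blinfun_apply (?D x t) v = t ^ Suc m * ?d x t v"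
      if "x \<in> ball x0 R" "t \<in> cbox 0 1" for x t v
      using du[OF that] has_derivative_bounded_linear
      by (subst bounded_linear_Blinfun_apply) (auto intro: bounded_linear_const_mult)
    have Ck: "Ck_on k (ball x0 R) (\<lambda>x. frechet_derivative u (at x) v)" for v
      using Suc.prems by simp
    have "continuous_on (ball x0 R \<times> cbox 0 1) (\<lambda>z. blinfun_apply (?D (fst z) (snd z)) v)" for v
      using cont[OF Ck[of v], of "Suc m"] by (rule continuous_on_eq) (simp add: D mem_Times_iff del: mem_ball cbox_interval box_real power_Suc)
    then have cD: "continuous_on (ball x0 R \<times> cbox 0 1) (\<lambda>(x, t). ?D x t)"
      unfolding case_prod_unfold by (rule continuous_on_blinfun_componentwise)
    have slice: "continuous_on (cbox 0 1) (\<lambda>t. h (x, t))"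
      if "continuous_on (ball x0 R \<times> cbox 0 1) h" "x \<in> ball x0 R"
      for x and h :: "'a \<times> real \<Rightarrow> 'd::topological_space"
      by (rule continuous_on_compose2[OF that(1)]) (use that(2) in \<open>auto intro!: continuous_intros\<close>)
    have cDx: "continuous_on (cbox 0 1) (?D x)" if "x \<in> ball x0 R" for x
      using slice[OF cD that] unfolding prod.case .
    have cu: "continuous_on (cbox 0 1) (\<lambda>t. t ^ m * u (x0 + t *\<^sub>R (x - x0)))" if "x \<in> ball x0 R" for x
      using slice[OF cont[OF Suc.prems, of m] that] unfolding fst_conv snd_conv .
    show ?case
    proof (rule Ck_on_SucI)
      fix x assume x: "x \<in> ball x0 R"
      have "((\<lambda>x. t ^ m * u (x0 + t *\<^sub>R (x - x0))) has_derivative ?D y t) (at y within ball x0 R)"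
        if "y \<in> ball x0 R" "t \<in> cbox 0 1" for y t
      proof -
        interpret d: bounded_linear "?d y t"
          using du[OF that] has_derivative_bounded_linear by blast
        \<comment> \<open>One factor \<open>t\<close> of the weight is moved into the argument,
          which is the form the chain rule produces.\<close>
        have eq: "blinfun_apply (?D y t) = (\<lambda>v. t ^ m * ?d y t (t *\<^sub>R v))"
          unfolding fun_eq_iff D[OF that] d.scaleR by simp
        have "((\<lambda>x. x0 + t *\<^sub>R (x - x0)) has_derivative (\<lambda>v. t *\<^sub>R v)) (at y)"
          by (auto intro!: derivative_eq_intros)
        from has_derivative_compose[OF this du[OF that]]
        have "((\<lambda>x. t ^ m * u (x0 + t *\<^sub>R (x - x0))) has_derivative (\<lambda>v. t ^ m * ?d y t (t *\<^sub>R v))) (at y)"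
          by (rule has_derivative_mult_right)
        then have "((\<lambda>x. t ^ m * u (x0 + t *\<^sub>R (x - x0))) has_derivative ?D y t) (at y)"
          unfolding eq .
        then show ?thesis by (rule has_derivative_at_withinI)
      qed
      from leibniz_rule[OF this integrable_continuous[OF cu] cD x convex_ball]
      show "((\<lambda>x. integral (cbox 0 1) (\<lambda>t. t ^ m * u (x0 + t *\<^sub>R (x - x0)))) has_derivative
          blinfun_apply (integral (cbox 0 1) (?D x))) (at x)"
        unfolding at_within_open[OF x open_ball] .
    next
      fix v
      show "Ck_on k (ball x0 R) (\<lambda>x. blinfun_apply (integral (cbox 0 1) (?D x)) v)"
      proof (rule Ck_on_cong[OF Suc.IH[OF Ck[of v], of "Suc m"]])
        fix x assume x: "x \<in> ball x0 R"
        have "blinfun_apply (integral (cbox 0 1) (?D x)) v = integral (cbox 0 1) (\<lambda>t. blinfun_apply (?D x t) v)"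
          by (rule blinfun_apply_integral[OF integrable_continuous[OF cDx[OF x]]])
        also have "\<dots> = integral (cbox 0 1) (\<lambda>t. t ^ Suc m * frechet_derivative u (at (x0 + t *\<^sub>R (x - x0))) v)"
          by (rule integral_cong) (simp add: D[OF x] del: power_Suc)
        finally show "integral (cbox 0 1) (\<lambda>t. t ^ Suc m * frechet_derivative u (at (x0 + t *\<^sub>R (x - x0))) v)
            = blinfun_apply (integral (cbox 0 1) (?D x)) v" by simp
      qed simp
    qed simp
  }
qed

text \<open>Integrate the derivative of \<open>f\<close> along the segment from \<open>x0\<close> to
  \<open>x\<close> and expand the direction \<open>x - x0\<close> in the basis; the coefficients are
  the radial integrals of the partial derivatives.\<close>

lemma Hadamard:
  fixes f :: "'a::euclidean_space \<Rightarrow> real"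
  assumes "smooth_on (ball x0 R) f" "R > 0"
  obtains h where "\<And>i. smooth_on (ball x0 R) (h i)"
    "\<And>i. h i x0 = frechet_derivative f (at x0) i"
    "\<And>x. x \<in> ball x0 R \<Longrightarrow> f x - f x0 = (\<Sum>i\<in>Basis. ((x - x0) \<bullet> i) * h i x)"
proof
  let ?f = "\<lambda>x. frechet_derivative f (at x)"
  \<comment> \<open>The trivial weight \<open>t ^ 0\<close> brings the integral into the form of
    \<open>Ck_on_radial_integral\<close>.\<close>
  let ?h = "\<lambda>i x. integral (cbox 0 (1::real)) (\<lambda>t. t ^ 0 * ?f (x0 + t *\<^sub>R (x - x0)) i)"
  show smooth: "smooth_on (ball x0 R) (?h i)" for i
    using smooth_on_frechet_derivative[OF assms(1), of i] unfolding smooth_on_def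
    by (intro allI Ck_on_radial_integral) auto
  show "?h i x0 = ?f x0 i" for i by simp
  fix x assume x: "x \<in> ball x0 R"
  have in_ball: "x0 + t *\<^sub>R (x - x0) \<in> ball x0 R" if "t \<in> {0..1}" for t
  proof -
    have "t * norm (x - x0) \<le> 1 * norm (x - x0)" using that by (intro mult_right_mono) auto
    with that x show ?thesis by (simp add: dist_norm norm_minus_commute)
  qed
  have lin: "?f y (x - x0) = (\<Sum>i\<in>Basis. ((x - x0) \<bullet> i) * ?f y i)" if "y \<in> ball x0 R" for y
  proof -
    interpret bounded_linear "?f y"
      using smooth_on_has_derivative[OF assms(1) that] has_derivative_bounded_linear by blast
    show ?thesis by (subst euclidean_representation[of "x - x0", symmetric]) (simp only: sum scaleR real_scaleR_def)
  qed
  have "((\<lambda>t. f (x0 + t *\<^sub>R (x - x0))) has_vector_derivative ?f (x0 + t *\<^sub>R (x - x0)) (x - x0)) (at t within {0..1})"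
    if "t \<in> {0..1}" for t
  proof -
    note d = smooth_on_has_derivative[OF assms(1) in_ball[OF that]]
    have "((\<lambda>t. x0 + t *\<^sub>R (x - x0)) has_derivative (\<lambda>s. s *\<^sub>R (x - x0))) (at t within {0..1})"
      by (auto intro!: derivative_eq_intros)
    from has_derivative_compose[OF this d] show ?thesis
      using linear_simps(5)[OF has_derivative_bounded_linear[OF d]] by (simp add: has_vector_derivative_def)
  qed
  from fundamental_theorem_of_calculus[OF _ this]
  have "((\<lambda>t. ?f (x0 + t *\<^sub>R (x - x0)) (x - x0)) has_integral f x - f x0) (cbox 0 1)" by simp
  then have "f x - f x0 = integral (cbox 0 1) (\<lambda>t. ?f (x0 + t *\<^sub>R (x - x0)) (x - x0))"
    by (simp add: integral_unique)
  also have "\<dots> = integral (cbox 0 1) (\<lambda>t. \<Sum>i\<in>Basis. ((x - x0) \<bullet> i) * ?f (x0 + t *\<^sub>R (x - x0)) i)"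
    by (rule integral_cong) (use lin in_ball in auto)
  also have "\<dots> = (\<Sum>i\<in>Basis. integral (cbox 0 1) (\<lambda>t. ((x - x0) \<bullet> i) * ?f (x0 + t *\<^sub>R (x - x0)) i))"
  proof (rule integral_sum)
    fix i
    have "continuous_on (ball x0 R) (\<lambda>y. ?f y i)"
      using smooth_on_frechet_derivative[OF assms(1)] by (metis Ck_on.simps(1) smooth_on_def)
    then have "continuous_on (cbox 0 1) (\<lambda>t. ?f (x0 + t *\<^sub>R (x - x0)) i)"
      by (rule continuous_on_compose2) (use in_ball in \<open>auto intro!: continuous_intros\<close>)
    then show "(\<lambda>t. ((x - x0) \<bullet> i) * ?f (x0 + t *\<^sub>R (x - x0)) i) integrable_on cbox 0 1"
      by (intro integrable_continuous continuous_on_mult_left)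
  qed simp
  finally show "f x - f x0 = (\<Sum>i\<in>Basis. ((x - x0) \<bullet> i) * ?h i x)" by simp
qed

section \<open>Extending tangent vectors to vector fields\<close>

text \<open>\<open>S\<close> and the complement of the closed ball are open and cover the space, and
  \<open>u\<close> vanishes on the latter.\<close>

lemma smooth_on_UNIV_supported:
  assumes "smooth_on S u" "open S" "cball x0 r \<subseteq> S" "\<And>x. x \<notin> cball x0 r \<Longrightarrow> u x = 0"
  shows "smooth_on UNIV u"
proof (rule smooth_on_local)
  fix x
  show "\<exists>T. open T \<and> x \<in> T \<and> smooth_on T u"
  proof (cases "x \<in> cball x0 r")
    case True
    with assms show ?thesis by blast
  next
    case False
    have "smooth_on (- cball x0 r) u"
      by (rule smooth_on_cong[OF smooth_on_const[of _ 0]]) (use assms(4) in auto)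
    with False show ?thesis by (intro exI[of _ "- cball x0 r"]) auto
  qed
qed

section \<open>Globally smooth functions on a manifold\<close>

locale smooth_manifold =
  fixes A :: "('m::{t2_space, second_countable_topology}, 'e::euclidean_space) chart set"
  assumes atlas: "smooth_atlas A"
begin

lemma chart_exists: obtains U \<phi> where "(U, \<phi>) \<in> A" "p \<in> U"
  using atlas unfolding smooth_atlas_def by blast

lemma
  assumes "(U, \<phi>) \<in> A"
  shows open_chart_domain: "open U" and open_chart_image: "open (\<phi> ` U)"
    and chart_homeomorphism: "homeomorphism U (\<phi> ` U) \<phi> (inv_into U \<phi>)"
  using atlas assms unfolding smooth_atlas_def is_chart_def by auto

lemma chart_inverse: "(U, \<phi>) \<in> A \<Longrightarrow> q \<in> U \<Longrightarrow> inv_into U \<phi> (\<phi> q) = q"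
  using chart_homeomorphism homeomorphism_apply1 by blast

lemma open_chart_image_of:
  assumes "(U, \<phi>) \<in> A" "open W" "W \<subseteq> U"
  shows "open (\<phi> ` W)"
proof -
  have "openin (top_of_set U) W" using assms(2,3) by (simp add: open_subset)
  then have "openin (top_of_set (\<phi> ` U)) (\<phi> ` W)"
    by (rule homeomorphism_imp_open_map[OF chart_homeomorphism[OF assms(1)]])
  then show ?thesis using open_chart_image[OF assms(1)] openin_open_trans by blast
qed

lemma smooth_functions_chart:
  "f \<in> smooth_functions A \<Longrightarrow> (U, \<phi>) \<in> A \<Longrightarrow> smooth_on (\<phi> ` U) (f \<circ> inv_into U \<phi>)"
  unfolding smooth_functions_def by auto

lemma const_smooth: "(\<lambda>q. c) \<in> smooth_functions A"
  unfolding smooth_functions_def by (auto simp: o_def smooth_on_const)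

lemma add_smooth:
  assumes "f \<in> smooth_functions A" "h \<in> smooth_functions A"
  shows "(\<lambda>q. f q + h q) \<in> smooth_functions A"
  using assms open_chart_image unfolding smooth_functions_def
  by (fastforce simp: o_def intro: smooth_on_add)

lemma mult_smooth:
  assumes "f \<in> smooth_functions A" "h \<in> smooth_functions A"
  shows "(\<lambda>q. f q * h q) \<in> smooth_functions A"
  using assms open_chart_image unfolding smooth_functions_def
  by (fastforce simp: o_def intro: smooth_on_mult)

lemma sum_smooth:
  "(\<And>i. i \<in> I \<Longrightarrow> f i \<in> smooth_functions A) \<Longrightarrow> (\<lambda>q. \<Sum>i\<in>I. f i q) \<in> smooth_functions A"
  by (induction I rule: infinite_finite_induct) (auto intro: const_smooth add_smooth)

text \<open>Checked near each point of a second chart: inside \<open>U\<close> the function is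
  \<open>u\<close> composed with a transition map, and outside \<open>U\<close> it vanishes near the
  point.\<close>

lemma extend_by_zero_smooth:
  fixes u :: "'e \<Rightarrow> real"
  assumes chart: "(U, \<phi>) \<in> A" and u: "smooth_on UNIV u" "cball x0 r \<subseteq> \<phi> ` U"
    "\<And>x. x \<notin> cball x0 r \<Longrightarrow> u x = 0"
  shows "(\<lambda>q. if q \<in> U then u (\<phi> q) else 0) \<in> smooth_functions A"
  unfolding smooth_functions_def
proof safe
  fix V \<psi> assume V: "(V, \<psi>) \<in> A"
  let ?F = "\<lambda>q. if q \<in> U then u (\<phi> q) else 0"
  let ?inv = "inv_into V \<psi>"
  show "smooth_on (\<psi> ` V) (?F \<circ> ?inv)"
  proof (rule smooth_on_local)
    fix y assume "y \<in> \<psi> ` V"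
    then obtain q where q: "q \<in> V" "y = \<psi> q" by blast
    show "\<exists>T. open T \<and> y \<in> T \<and> smooth_on T (?F \<circ> ?inv)"
    proof (cases "q \<in> U")
      case True
      have op: "open (\<psi> ` (V \<inter> U))"
        by (intro open_chart_image_of[OF V] open_Int open_chart_domain[OF V] open_chart_domain[OF chart]) auto
      have "smooth_on (\<psi> ` (V \<inter> U)) (\<phi> \<circ> ?inv)"
        using atlas V chart unfolding smooth_atlas_def by fast
      then have "smooth_on (\<psi> ` (V \<inter> U)) (\<lambda>x. u ((\<phi> \<circ> ?inv) x))"
        by (rule smooth_on_compose[OF u(1) _ op]) simp
      then have "smooth_on (\<psi> ` (V \<inter> U)) (?F \<circ> ?inv)"
        by (rule smooth_on_cong[OF _ op]) (auto simp: chart_inverse[OF V])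
      then show ?thesis using op q True by blast
    next
      case False
      \<comment> \<open>The support pulled back to the manifold. It is compact, hence closed because
        the space is Hausdorff, so its complement is an open neighbourhood of \<open>q\<close> on
        which the extension is 0.\<close>
      let ?K = "inv_into U \<phi> ` cball x0 r"
      have "compact ?K"
        using chart_homeomorphism[OF chart] u(2)
        by (intro compact_continuous_image) (auto simp: homeomorphism_def intro: continuous_on_subset)
      then have op: "open (\<psi> ` (V - ?K))"
        by (intro open_chart_image_of[OF V] open_Diff open_chart_domain[OF V] compact_imp_closed) auto
      have "?K \<subseteq> U" using u(2) by (blast intro: inv_into_into)
      then have "q \<notin> ?K" using False by blast
      have zero: "u (\<phi> z) = 0" if "z \<in> U" "z \<notin> ?K" for z
        using u(3)[of "\<phi> z"] that chart_inverse[OF chart, of z] by (metis imageI)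
      have "smooth_on (\<psi> ` (V - ?K)) (?F \<circ> ?inv)"
        by (rule smooth_on_cong[OF smooth_on_const[of _ 0] op])
          (use zero chart_inverse[OF V] in \<open>auto simp del: image_iff\<close>)
      then show ?thesis using op q \<open>q \<notin> ?K\<close> by blast
    qed
  qed
qed

section \<open>Derivations at a point and cut-off directional derivatives\<close>

lemma tangent_space_lincomb:
  "v \<in> tangent_space A p \<Longrightarrow> f \<in> smooth_functions A \<Longrightarrow> h \<in> smooth_functions A \<Longrightarrow>
    v (\<lambda>q. a * f q + b * h q) = a * v f + b * v h"
  unfolding tangent_space_def by blast

lemma tangent_space_Leibniz:
  "v \<in> tangent_space A p \<Longrightarrow> f \<in> smooth_functions A \<Longrightarrow> h \<in> smooth_functions A \<Longrightarrow>
    v (\<lambda>q. f q * h q) = f p * v h + h p * v f"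
  unfolding tangent_space_def by blast

lemma tangent_space_not_smooth:
  "v \<in> tangent_space A p \<Longrightarrow> f \<notin> smooth_functions A \<Longrightarrow> v f = 0"
  unfolding tangent_space_def by blast

lemma tangent_space_const:
  assumes "v \<in> tangent_space A p"
  shows "v (\<lambda>q. c) = 0"
  \<comment> \<open>The Leibniz rule for 1 = 1 * 1 gives v(1) = 2 v(1), hence v(1) = 0; linearity
    then covers every constant.\<close>
  using tangent_space_Leibniz[OF assms const_smooth[of 1] const_smooth[of 1]]
    tangent_space_lincomb[OF assms const_smooth[of 1] const_smooth[of 1], of c 0] by simp

lemma tangent_space_sum:
  assumes "v \<in> tangent_space A p"
  shows "(\<And>i. i \<in> I \<Longrightarrow> f i \<in> smooth_functions A) \<Longrightarrow> v (\<lambda>q. \<Sum>i\<in>I. f i q) = (\<Sum>i\<in>I. v (f i))"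
proof (induction I rule: infinite_finite_induct)
  case (insert i I)
  then show ?case
    using tangent_space_lincomb[OF assms, of "f i" "\<lambda>q. \<Sum>i\<in>I. f i q" 1 1] sum_smooth[of I f] by simp
qed (simp_all add: tangent_space_const[OF assms])

text \<open>The constant coordinate field \<open>w\<close> of one chart, multiplied by the cutoff so
  that it extends by zero to the whole manifold. The value 0 on non-smooth functions follows the
  convention of \<open>tangent_space\<close>.\<close>

lemma frechet_vector_field:
  assumes chart: "(U, \<phi>) \<in> A" and \<beta>: "smooth_on UNIV \<beta>" "cball x0 r \<subseteq> \<phi> ` U"
    "\<And>x. x \<notin> cball x0 r \<Longrightarrow> \<beta> x = 0"
  shows "(\<lambda>q f. if q \<in> U \<and> f \<in> smooth_functions A
            then \<beta> (\<phi> q) * frechet_derivative (f \<circ> inv_into U \<phi>) (at (\<phi> q)) w else 0) \<in> vector_fields A"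
    (is "?X \<in> _")
proof -
  have d: "((f \<circ> inv_into U \<phi>) has_derivative frechet_derivative (f \<circ> inv_into U \<phi>) (at (\<phi> q))) (at (\<phi> q))"
    if "f \<in> smooth_functions A" "q \<in> U" for f q
    using smooth_on_has_derivative[OF smooth_functions_chart[OF that(1) chart]] that(2) by blast
  have lin: "?X q (\<lambda>x. a * f x + b * h x) = a * ?X q f + b * ?X q h"
    if f: "f \<in> smooth_functions A" and h: "h \<in> smooth_functions A" for q f h a b
  proof (cases "q \<in> U")
    case True
    have s: "(\<lambda>x. a * f x + b * h x) \<in> smooth_functions A"
      by (intro add_smooth mult_smooth const_smooth f h)
    have "(((\<lambda>x. a * f x + b * h x) \<circ> inv_into U \<phi>) has_derivative
        (\<lambda>v. a * frechet_derivative (f \<circ> inv_into U \<phi>) (at (\<phi> q)) v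
          + b * frechet_derivative (h \<circ> inv_into U \<phi>) (at (\<phi> q)) v)) (at (\<phi> q))"
      using has_derivative_add[OF has_derivative_mult_right[OF d[OF f True], of a]
          has_derivative_mult_right[OF d[OF h True], of b]] by (simp add: o_def)
    from frechet_derivative_at[OF this, symmetric] show ?thesis
      using True s f h by (simp add: algebra_simps)
  qed simp
  have leib: "?X q (\<lambda>x. f x * h x) = f q * ?X q h + h q * ?X q f"
    if f: "f \<in> smooth_functions A" and h: "h \<in> smooth_functions A" for q f h
  proof (cases "q \<in> U")
    case True
    have "(((\<lambda>x. f x * h x) \<circ> inv_into U \<phi>) has_derivative
        (\<lambda>v. f q * frechet_derivative (h \<circ> inv_into U \<phi>) (at (\<phi> q)) v
          + frechet_derivative (f \<circ> inv_into U \<phi>) (at (\<phi> q)) v * h q)) (at (\<phi> q))"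
      using has_derivative_mult[OF d[OF f True] d[OF h True]] chart_inverse[OF chart True]
      by (simp add: o_def)
    from frechet_derivative_at[OF this, symmetric] show ?thesis
      using True mult_smooth[OF f h] f h by (simp add: algebra_simps)
  qed simp
  have "?X q \<in> tangent_space A q" for q
    unfolding tangent_space_def using lin leib by auto
  moreover have "(\<lambda>q. ?X q f) \<in> smooth_functions A" if f: "f \<in> smooth_functions A" for f
  proof -
    let ?u = "\<lambda>x. \<beta> x * frechet_derivative (f \<circ> inv_into U \<phi>) (at x) w"
    have "smooth_on (\<phi> ` U) ?u"
      by (intro smooth_on_mult smooth_on_frechet_derivative smooth_functions_chart[OF f chart]
          open_chart_image[OF chart] smooth_on_subset[OF \<beta>(1)]) auto
    then have "smooth_on UNIV ?u"
      by (rule smooth_on_UNIV_supported[OF _ open_chart_image[OF chart] \<beta>(2)]) (simp add: \<beta>(3))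
    from extend_by_zero_smooth[OF chart this \<beta>(2)] show ?thesis
      using f \<beta>(3) by simp
  qed
  ultimately show ?thesis unfolding vector_fields_def by blast
qed

text \<open>By Hadamard's lemma \<open>\<beta>\<^sup>2 (f - f p)\<close> is a sum of products \<open>(\<beta> (x - x\<^sub>0)\<^sub>i) (\<beta> h\<^sub>i)\<close> of globally
  smooth functions, so \<open>v\<close> is the directional derivative along \<open>\<Sum>\<^sub>i v(\<beta> (x - x\<^sub>0)\<^sub>i) e\<^sub>i\<close>.\<close>

lemma tangent_vector_extends:
  assumes v: "v \<in> tangent_space A p"
  obtains X where "X \<in> vector_fields A" "X p = v"
proof -
  obtain U \<phi> where chart: "(U, \<phi>) \<in> A" and p: "p \<in> U" by (rule chart_exists)
  let ?x0 = "\<phi> p" and ?inv = "inv_into U \<phi>"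
  obtain R where R: "R > 0" "ball ?x0 R \<subseteq> \<phi> ` U"
    using open_chart_image[OF chart] p by (metis imageI open_contains_ball)
  \<comment> \<open>Two radii are needed: Hadamard's coefficients exist on the ball of radius
    \<open>R\<close>, and the cutoff lives on the smaller closed ball, so their products with it
    extend smoothly by zero.\<close>
  define r where "r = R / 2"
  have r: "r > 0" "cball ?x0 r \<subseteq> ball ?x0 R" using R by (auto simp: r_def)
  then have r': "cball ?x0 r \<subseteq> \<phi> ` U" using R by blast
  obtain \<beta> :: "'e \<Rightarrow> real" where \<beta>: "smooth_on UNIV \<beta>" "\<beta> ?x0 = 1" "\<And>x. x \<notin> cball ?x0 r \<Longrightarrow> \<beta> x = 0"
    using smooth_bump[OF r(1), of ?x0] by metis
  let ?ext = "\<lambda>u q. if q \<in> U then u (\<phi> q) else (0::real)"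
  let ?b = "?ext \<beta>"
  let ?y = "\<lambda>i. ?ext (\<lambda>x. \<beta> x * ((x - ?x0) \<bullet> i))"
  have b: "?b \<in> smooth_functions A"
    by (rule extend_by_zero_smooth[OF chart \<beta>(1) r' \<beta>(3)])
  have y: "?y i \<in> smooth_functions A" for i
  proof (rule extend_by_zero_smooth[OF chart _ r'])
    have "smooth_on UNIV (\<lambda>x. \<beta> x * ((x + - ?x0) \<bullet> i))"
      by (intro smooth_on_mult \<beta>(1) smooth_on_inner smooth_on_add smooth_on_const smooth_on_linear
          bounded_linear_ident open_UNIV)
    then show "smooth_on UNIV (\<lambda>x. \<beta> x * ((x - ?x0) \<bullet> i))" by simp
  qed (simp add: \<beta>(3))
  define w where "w = (\<Sum>i\<in>Basis. v (?y i) *\<^sub>R i)"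
  let ?X = "\<lambda>q f. if q \<in> U \<and> f \<in> smooth_functions A
    then \<beta> (\<phi> q) * frechet_derivative (f \<circ> ?inv) (at (\<phi> q)) w else 0"
  have "?X p f = v f" for f
  proof (cases "f \<in> smooth_functions A")
    case f: True
    let ?f = "f \<circ> ?inv"
    have smooth: "smooth_on (ball ?x0 R) ?f"
      using smooth_functions_chart[OF f chart] R(2) by (rule smooth_on_subset)
    obtain h where h: "\<And>i. smooth_on (ball ?x0 R) (h i)"
      "\<And>i. h i ?x0 = frechet_derivative ?f (at ?x0) i"
      "\<And>x. x \<in> ball ?x0 R \<Longrightarrow> ?f x - ?f ?x0 = (\<Sum>i\<in>Basis. ((x - ?x0) \<bullet> i) * h i x)"
      using Hadamard[OF smooth R(1)] by blast
    let ?h = "\<lambda>i. ?ext (\<lambda>x. \<beta> x * h i x)"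
    have hs: "?h i \<in> smooth_functions A" for i
    proof (rule extend_by_zero_smooth[OF chart _ r'])
      have "smooth_on (ball ?x0 R) (\<lambda>x. \<beta> x * h i x)"
        by (intro smooth_on_mult h(1) smooth_on_subset[OF \<beta>(1)]) auto
      then show "smooth_on UNIV (\<lambda>x. \<beta> x * h i x)"
        by (rule smooth_on_UNIV_supported[OF _ open_ball r(2)]) (simp add: \<beta>(3))
    qed (simp add: \<beta>(3))
    have fp: "(\<lambda>q. f q + - f p) \<in> smooth_functions A"
      by (intro add_smooth f const_smooth)
    have "?b q * ?b q * (f q + - f p) = (\<Sum>i\<in>Basis. ?y i q * ?h i q)" for q
    proof (cases "q \<in> U \<and> \<phi> q \<in> ball ?x0 R")
      case True
      then show ?thesis
        using h(3)[of "\<phi> q"] chart_inverse[OF chart] p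
        by (simp add: sum_distrib_left ac_simps)
    next
      case False
      then have "q \<notin> U \<or> \<beta> (\<phi> q) = 0" using \<beta>(3) r(2) by blast
      then show ?thesis by auto
    qed
    then have "v (\<lambda>q. ?b q * ?b q * (f q + - f p)) = v (\<lambda>q. \<Sum>i\<in>Basis. ?y i q * ?h i q)"
      by presburger
    also have "\<dots> = (\<Sum>i\<in>Basis. v (\<lambda>q. ?y i q * ?h i q))"
      by (rule tangent_space_sum[OF v]) (intro mult_smooth y hs)
    also have "\<dots> = (\<Sum>i\<in>Basis. v (?y i) * frechet_derivative ?f (at ?x0) i)"
    proof (rule sum.cong)
      fix i
      show "v (\<lambda>q. ?y i q * ?h i q) = v (?y i) * frechet_derivative ?f (at ?x0) i"
        \<comment> \<open>At \<open>p\<close> the cut-off coordinate is 0 and the cut-off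
          coefficient is the partial derivative, so only one of the two Leibniz terms
          survives.\<close>
        using tangent_space_Leibniz[OF v y[of i] hs[of i]] p \<beta>(2) h(2) by simp
    qed simp
    also have "\<dots> = frechet_derivative ?f (at ?x0) w"
    proof -
      interpret bounded_linear "frechet_derivative ?f (at ?x0)"
        using smooth_on_has_derivative[OF smooth, of ?x0] R(1)
        by (intro has_derivative_bounded_linear[of ?f]) auto
      show ?thesis by (simp add: w_def sum scaleR)
    qed
    finally have "v (\<lambda>q. ?b q * ?b q * (f q + - f p)) = frechet_derivative ?f (at ?x0) w" .
    moreover have "v (\<lambda>q. ?b q * ?b q * (f q + - f p)) = v (\<lambda>q. f q + - f p)"
      \<comment> \<open>The second factor vanishes at \<open>p\<close> and the squared cutoff is 1
        there, so \<open>v\<close> does not see the cutoff.\<close>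
      using tangent_space_Leibniz[OF v mult_smooth[OF b b] fp] p \<beta>(2) by simp
    moreover have "v (\<lambda>q. f q + - f p) = v f"
      using tangent_space_lincomb[OF v f const_smooth[of "- f p"], of 1 1] tangent_space_const[OF v] by simp
    ultimately show ?thesis using f p \<beta>(2) by simp
  qed (simp add: tangent_space_not_smooth[OF v])
  then have "?X p = v" by blast
  with frechet_vector_field[OF chart \<beta>(1) r' \<beta>(3), of w] show ?thesis using that by blast
qed

end

section \<open>Norden manifolds\<close>

context smooth_manifold
begin

lemma vector_field_tangent: "X \<in> vector_fields A \<Longrightarrow> X p \<in> tangent_space A p"
  unfolding vector_fields_def by blast

lemma lincomb_tangent_space:
  assumes "u \<in> tangent_space A p" "v \<in> tangent_space A p"
  shows "(\<lambda>f. a * u f + b * v f) \<in> tangent_space A p"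
  using assms unfolding tangent_space_def by (auto simp: algebra_simps)

lemma lincomb_vector_field:
  assumes "X \<in> vector_fields A" "Y \<in> vector_fields A"
  shows "(\<lambda>p f. a * X p f + b * Y p f) \<in> vector_fields A"
  using assms lincomb_tangent_space
  unfolding vector_fields_def by (auto intro!: add_smooth mult_smooth const_smooth)

lemma metric_lincomb_left:
  assumes "pseudo_riemannian_metric A g"
    "u \<in> tangent_space A p" "v \<in> tangent_space A p" "w \<in> tangent_space A p"
  shows "g p (\<lambda>f. a * u f + b * v f) w = a * g p u w + b * g p v w"
  using assms unfolding pseudo_riemannian_metric_def by blast

lemma metric_sym:
  assumes "pseudo_riemannian_metric A g" "u \<in> tangent_space A p" "v \<in> tangent_space A p"
  shows "g p u v = g p v u"
  using assms unfolding pseudo_riemannian_metric_def by blast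

text \<open>Nondegeneracy tests against tangent vectors at \<open>p\<close>, and each of these is
  the value of a global vector field by \<open>tangent_vector_extends\<close>.\<close>

lemma metric_nondegenerate_on_vector_fields:
  assumes g: "pseudo_riemannian_metric A g" and W: "W \<in> vector_fields A"
    and zero: "\<And>Z. Z \<in> vector_fields A \<Longrightarrow> g p (W p) (Z p) = 0"
  shows "W p = (\<lambda>f. 0)"
proof -
  have "g p (W p) v = 0" if "v \<in> tangent_space A p" for v
    using tangent_vector_extends[OF that] zero by metis
  then show ?thesis
    using g vector_field_tangent[OF W] unfolding pseudo_riemannian_metric_def by blast
qed

end

section \<open>Symmetries of \<open>F\<close> for a single Norden metric\<close>

locale norden_manifold = smooth_manifold A
  for A :: "('m::{t2_space, second_countable_topology}, 'e::euclidean_space) chart set" +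
  fixes J :: "'m \<Rightarrow> 'm tvec \<Rightarrow> 'm tvec"
    and g :: "'m \<Rightarrow> 'm tvec \<Rightarrow> 'm tvec \<Rightarrow> real"
    and D :: "'m vfield \<Rightarrow> 'm vfield \<Rightarrow> 'm vfield"
  assumes norden: "almost_complex_norden A J g" and lc: "levi_civita A g D"
begin

lemma metric: "pseudo_riemannian_metric A g"
  using norden unfolding almost_complex_norden_def by blast

lemma appJ_vector_field: "X \<in> vector_fields A \<Longrightarrow> appJ J X \<in> vector_fields A"
  using norden unfolding almost_complex_norden_def tensor_field_1_1_def appJ_def by blast

lemma appJ_appJ: "X \<in> vector_fields A \<Longrightarrow> appJ J (appJ J X) = (\<lambda>p f. - X p f)"
  using norden unfolding almost_complex_norden_def by blast

lemma connection_vector_field: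
  "X \<in> vector_fields A \<Longrightarrow> Y \<in> vector_fields A \<Longrightarrow> D X Y \<in> vector_fields A"
  using lc unfolding levi_civita_def affine_connection_def by blast

lemma nablaJ_vector_field:
  assumes "X \<in> vector_fields A" "Y \<in> vector_fields A"
  shows "nablaJ D J X Y \<in> vector_fields A"
  using lincomb_vector_field[OF connection_vector_field[OF assms(1) appJ_vector_field[OF assms(2)]]
      appJ_vector_field[OF connection_vector_field[OF assms]], of 1 "-1"]
  by (simp add: nablaJ_def)

lemma torsion_free:
  "X \<in> vector_fields A \<Longrightarrow> Y \<in> vector_fields A \<Longrightarrow>
    (\<lambda>p f. D X Y p f - D Y X p f) = lie_bracket X Y"
  using lc unfolding levi_civita_def by blast

lemma metric_compatible:
  "X \<in> vector_fields A \<Longrightarrow> Y \<in> vector_fields A \<Longrightarrow> Z \<in> vector_fields A \<Longrightarrow>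
    X p (\<lambda>q. g q (Y q) (Z q)) = g p (D X Y p) (Z p) + g p (Y p) (D X Z p)"
  using lc unfolding levi_civita_def by blast

lemma g_sym:
  "X \<in> vector_fields A \<Longrightarrow> Y \<in> vector_fields A \<Longrightarrow> g p (X p) (Y p) = g p (Y p) (X p)"
  by (simp add: metric_sym[OF metric] vector_field_tangent)

lemma g_lincomb:
  assumes "X \<in> vector_fields A" "Y \<in> vector_fields A" "Z \<in> vector_fields A"
  shows "g p (\<lambda>f. a * X p f + b * Y p f) (Z p) = a * g p (X p) (Z p) + b * g p (Y p) (Z p)"
  by (rule metric_lincomb_left[OF metric]) (simp_all add: vector_field_tangent assms)

lemma g_diff:
  assumes "X \<in> vector_fields A" "Y \<in> vector_fields A" "Z \<in> vector_fields A"
  shows "g p (\<lambda>f. X p f - Y p f) (Z p) = g p (X p) (Z p) - g p (Y p) (Z p)"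
  using g_lincomb[OF assms, of p 1 "-1"] by simp

lemma g_minus:
  assumes "X \<in> vector_fields A" "Z \<in> vector_fields A"
  shows "g p (\<lambda>f. - X p f) (Z p) = - g p (X p) (Z p)"
  using g_lincomb[OF assms(1) assms(1,2), of p "-1" 0] by simp

lemma g_appJ_appJ:
  "X \<in> vector_fields A \<Longrightarrow> Y \<in> vector_fields A \<Longrightarrow>
    g p (appJ J X p) (appJ J Y p) = - g p (X p) (Y p)"
  using norden unfolding almost_complex_norden_def by blast

text \<open>Put \<open>JY\<close> for \<open>Y\<close> in the Norden condition and use J^2 = -1:
  \<open>J\<close> is self-adjoint rather than skew as in the Hermitian case.\<close>

lemma g_appJ_left:
  assumes X: "X \<in> vector_fields A" and Y: "Y \<in> vector_fields A"
  shows "g p (appJ J X p) (Y p) = g p (X p) (appJ J Y p)"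
proof -
  have "- g p (X p) (appJ J Y p) = g p (appJ J X p) (appJ J (appJ J Y) p)"
    using g_appJ_appJ[OF X appJ_vector_field[OF Y]] by simp
  also have "\<dots> = g p (\<lambda>f. - Y p f) (appJ J X p)"
    using g_sym[OF appJ_vector_field[OF X] appJ_vector_field[OF appJ_vector_field[OF Y]]]
    by (simp add: appJ_appJ[OF Y])
  also have "\<dots> = - g p (appJ J X p) (Y p)"
    using g_minus[OF Y appJ_vector_field[OF X]] g_sym[OF Y appJ_vector_field[OF X]] by simp
  finally show ?thesis by simp
qed

abbreviation "F \<equiv> F_tensor D J g"

lemma F_eq:
  assumes "X \<in> vector_fields A" "Y \<in> vector_fields A" "Z \<in> vector_fields A"
  shows "F X Y Z p = g p (D X (appJ J Y) p) (Z p) - g p (D X Y p) (appJ J Z p)"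
proof -
  have "F X Y Z p = g p (D X (appJ J Y) p) (Z p) - g p (appJ J (D X Y) p) (Z p)"
    unfolding F_tensor_def nablaJ_def
    by (rule g_diff) (simp_all add: connection_vector_field appJ_vector_field assms)
  then show ?thesis by (simp add: g_appJ_left connection_vector_field assms)
qed

text \<open>Differentiate g(JY, Z) = g(Y, JZ) along \<open>X\<close> by metric
  compatibility.\<close>

lemma F_sym:
  assumes X: "X \<in> vector_fields A" and Y: "Y \<in> vector_fields A" and Z: "Z \<in> vector_fields A"
  shows "F X Y Z p = F X Z Y p"
proof -
  note JY = appJ_vector_field[OF Y] and JZ = appJ_vector_field[OF Z]
  have "(\<lambda>q. g q (appJ J Y q) (Z q)) = (\<lambda>q. g q (Y q) (appJ J Z q))"
    using g_appJ_left[OF Y Z] by blast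
  then have "g p (D X (appJ J Y) p) (Z p) + g p (appJ J Y p) (D X Z p) =
      g p (D X Y p) (appJ J Z p) + g p (Y p) (D X (appJ J Z) p)"
    using metric_compatible[OF X JY Z] metric_compatible[OF X Y JZ] by metis
  then show ?thesis
    using F_eq[OF X Y Z] F_eq[OF X Z Y] g_sym[OF JY connection_vector_field[OF X Z]]
      g_sym[OF Y connection_vector_field[OF X JZ]] by simp
qed

lemma connection_Leibniz:
  assumes "X \<in> vector_fields A" "Y \<in> vector_fields A" "a \<in> smooth_functions A"
  shows "D X (\<lambda>p f. a p * Y p f) = (\<lambda>p f. X p a * Y p f + a p * D X Y p f)"
  using lc assms unfolding levi_civita_def affine_connection_def by blast

lemma connection_minus:
  assumes X: "X \<in> vector_fields A" and Y: "Y \<in> vector_fields A"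
  shows "D X (\<lambda>p f. - Y p f) = (\<lambda>p f. - D X Y p f)"
  \<comment> \<open>Negation is multiplication by the constant function -1, whose derivative along
    \<open>X\<close> is 0.\<close>
  using connection_Leibniz[OF X Y const_smooth[of "-1"]]
    tangent_space_const[OF vector_field_tangent[OF X]] by simp

text \<open>Differentiating J^2 = -1 shows that the covariant derivative of \<open>J\<close>
  anticommutes with \<open>J\<close>; self-adjointness then moves \<open>J\<close> to the last
  argument.\<close>

lemma F_appJ_middle:
  assumes X: "X \<in> vector_fields A" and Y: "Y \<in> vector_fields A" and Z: "Z \<in> vector_fields A"
  shows "F X (appJ J Y) Z p = - F X Y (appJ J Z) p"
proof -
  note JY = appJ_vector_field[OF Y] and JZ = appJ_vector_field[OF Z]
  note DXY = connection_vector_field[OF X Y]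
  have "F X (appJ J Y) Z p = g p (\<lambda>f. - D X Y p f) (Z p) - g p (D X (appJ J Y) p) (appJ J Z p)"
    using F_eq[OF X JY Z] by (simp add: appJ_appJ[OF Y] connection_minus[OF X Y])
  moreover have "g p (\<lambda>f. - D X Y p f) (Z p) = g p (D X Y p) (appJ J (appJ J Z) p)"
    using g_appJ_appJ[OF DXY Z] g_appJ_left[OF DXY JZ] g_minus[OF DXY Z] by simp
  ultimately show ?thesis using F_eq[OF X Y JZ] by simp
qed

end

section \<open>The difference of the two Levi-Civita connections\<close>

locale associated_norden_pair =
  norden_manifold A J g D + tilde: norden_manifold A J gt Dt
  for A :: "('m::{t2_space, second_countable_topology}, 'e::euclidean_space) chart set"
    and J g gt D Dt +
  assumes gt_def: "gt = associated_metric J g"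
begin

lemma gt_eq: "gt p (X p) (Y p) = g p (X p) (appJ J Y p)"
  by (simp add: gt_def associated_metric_def appJ_def)

definition connection_diff :: "'m vfield \<Rightarrow> 'm vfield \<Rightarrow> 'm vfield" where
  "connection_diff X Y = (\<lambda>p f. Dt X Y p f - D X Y p f)"

text \<open>Both connections have the Lie bracket as their antisymmetric part, so it cancels in the
  difference.\<close>

lemma connection_diff_commute:
  assumes "X \<in> vector_fields A" "Y \<in> vector_fields A"
  shows "connection_diff X Y = connection_diff Y X"
proof -
  have "(\<lambda>p f. Dt X Y p f - Dt Y X p f) = (\<lambda>p f. D X Y p f - D Y X p f)"
    using tilde.torsion_free[OF assms] torsion_free[OF assms] by simp
  then have "Dt X Y p f - Dt Y X p f = D X Y p f - D Y X p f" for p f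
    by meson
  then show ?thesis
    unfolding connection_diff_def by (intro ext) (smt (verit))
qed

lemma gt_connection_diff:
  assumes "X \<in> vector_fields A" "Y \<in> vector_fields A" "Z \<in> vector_fields A"
  shows "gt p (connection_diff X Y p) (Z p) = gt p (Dt X Y p) (Z p) - gt p (D X Y p) (Z p)"
  unfolding connection_diff_def
  by (rule tilde.g_diff) (simp_all add: connection_vector_field tilde.connection_vector_field assms)

text \<open>Expand the derivative of gt(Y, Z) = g(Y, JZ) along \<open>X\<close> with either
  connection. Passing from D_X(JZ) to J(D_X Z) on the \<open>g\<close> side leaves
  \<open>F X Z Y\<close>, which \<open>F_sym\<close> turns into the stated order.\<close>

lemma F_eq_connection_diff:
  assumes X: "X \<in> vector_fields A" and Y: "Y \<in> vector_fields A" and Z: "Z \<in> vector_fields A"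
  shows "F X Y Z p = gt p (connection_diff X Y p) (Z p) + gt p (connection_diff X Z p) (Y p)"
proof -
  note JZ = appJ_vector_field[OF Z]
  have "(\<lambda>q. gt q (Y q) (Z q)) = (\<lambda>q. g q (Y q) (appJ J Z q))"
    using gt_eq by blast
  then have "gt p (Dt X Y p) (Z p) + gt p (Y p) (Dt X Z p) =
      g p (D X Y p) (appJ J Z p) + g p (Y p) (D X (appJ J Z) p)"
    using tilde.metric_compatible[OF X Y Z] metric_compatible[OF X Y JZ] by metis
  moreover have "gt p (Y p) (Dt X Z p) = gt p (Dt X Z p) (Y p)"
    using tilde.g_sym[OF Y tilde.connection_vector_field[OF X Z]] .
  moreover have "g p (Y p) (D X (appJ J Z) p) = g p (D X (appJ J Z) p) (Y p)"
    using g_sym[OF Y connection_vector_field[OF X JZ]] .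
  ultimately show ?thesis
    using F_sym[OF X Y Z] F_eq[OF X Z Y] gt_connection_diff[OF X Y Z] gt_connection_diff[OF X Z Y]
      gt_eq[of p "D X Y" Z] gt_eq[of p "D X Z" Y] by simp
qed

text \<open>Add \<open>F_eq_connection_diff\<close> for two cyclic orders and subtract the third: by
  symmetry of the difference, four of the six terms cancel and the remaining two coincide.\<close>

lemma Koszul_connection_diff:
  assumes X: "X \<in> vector_fields A" and Y: "Y \<in> vector_fields A" and Z: "Z \<in> vector_fields A"
  shows "2 * gt p (connection_diff X Y p) (Z p) = F X Y Z p + F Y Z X p - F Z X Y p"
  using F_eq_connection_diff[OF X Y Z] F_eq_connection_diff[OF Y Z X] F_eq_connection_diff[OF Z X Y]
    connection_diff_commute[OF X Y] connection_diff_commute[OF Y Z] connection_diff_commute[OF Z X]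
  by simp

text \<open>Write \<open>Dt\<close> as \<open>D\<close> plus the difference in
  \<open>tilde.F_eq\<close>; the \<open>D\<close> part, rewritten through \<open>g\<close>, is
  \<open>F X Y (appJ J Z)\<close>.\<close>

lemma F_tilde_eq:
  assumes X: "X \<in> vector_fields A" and Y: "Y \<in> vector_fields A" and Z: "Z \<in> vector_fields A"
  shows "tilde.F X Y Z p = F X Y (appJ J Z) p
    + gt p (connection_diff X (appJ J Y) p) (Z p) - gt p (connection_diff X Y p) (appJ J Z p)"
proof -
  note JY = appJ_vector_field[OF Y] and JZ = appJ_vector_field[OF Z]
  show ?thesis
    using tilde.F_eq[OF X Y Z] F_eq[OF X Y JZ] gt_connection_diff[OF X JY Z]
      gt_connection_diff[OF X Y JZ] gt_eq[of p "D X (appJ J Y)" Z] gt_eq[of p "D X Y" "appJ J Z"]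
    by simp
qed

end

section \<open>The two identities, from the cyclic sum and nondegeneracy\<close>

theorem theorem2p2:
  fixes A :: "('m::{t2_space, second_countable_topology}, 'e::euclidean_space) chart set"
    and J :: "'m \<Rightarrow> 'm tvec \<Rightarrow> 'm tvec"
    and g gt :: "'m \<Rightarrow> 'm tvec \<Rightarrow> 'm tvec \<Rightarrow> real"
    and D Dt :: "'m vfield \<Rightarrow> 'm vfield \<Rightarrow> 'm vfield"
  assumes "gt = associated_metric J g"
    and "quasi_kaehler_norden A J g D"
    and "quasi_kaehler_norden A J gt Dt"
  shows "(\<forall>X\<in>vector_fields A. \<forall>Y\<in>vector_fields A. \<forall>Z\<in>vector_fields A. \<forall>p.
            F_tensor Dt J gt X Y Z p = - F_tensor D J g (appJ J X) Y Z p) \<and>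
         (\<forall>X\<in>vector_fields A. \<forall>Y\<in>vector_fields A. \<forall>p f.
            nablaJ Dt J X Y p f = - nablaJ D J (appJ J X) (appJ J Y) p f)"
proof -
  interpret associated_norden_pair A J g gt D Dt
    using assms unfolding quasi_kaehler_norden_def
    by unfold_locales (blast | simp add: almost_complex_norden_def)+
  have cyclic: "F X Y Z p + F Y Z X p + F Z X Y p = 0"
    if "X \<in> vector_fields A" "Y \<in> vector_fields A" "Z \<in> vector_fields A" for X Y Z p
    using assms(2) that unfolding quasi_kaehler_norden_def by blast
  \<comment> \<open>The cyclic sum turns the first two Koszul terms into \<open>- F Z X Y p\<close>,
    so the right-hand side becomes twice this value.\<close>
  have diff: "gt p (connection_diff X Y p) (Z p) = - F Z X Y p"
    if "X \<in> vector_fields A" "Y \<in> vector_fields A" "Z \<in> vector_fields A" for X Y Z p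
    using Koszul_connection_diff[OF that, of p] cyclic[OF that, of p] by simp
  have F: "tilde.F X Y Z p = - F (appJ J X) Y Z p"
    if X: "X \<in> vector_fields A" and Y: "Y \<in> vector_fields A" and Z: "Z \<in> vector_fields A" for X Y Z p
  proof -
    note JX = appJ_vector_field[OF X] and JY = appJ_vector_field[OF Y] and JZ = appJ_vector_field[OF Z]
    have "tilde.F X Y Z p = F X Y (appJ J Z) p - F Z X (appJ J Y) p + F (appJ J Z) X Y p"
      using F_tilde_eq[OF X Y Z] diff[OF X JY Z] diff[OF X Y JZ] by simp
    \<comment> \<open>The cyclic sum at \<open>X\<close>, \<open>Y\<close>, \<open>JZ\<close>
      removes the two terms other than \<open>F Z X (appJ J Y)\<close>. What remains then has its
      \<open>J\<close> shifted onto \<open>X\<close>, ready for the cyclic sum at \<open>JX\<close>,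
      \<open>Y\<close>, \<open>Z\<close>.\<close>
    also have "\<dots> = - F Z X (appJ J Y) p - F Y (appJ J Z) X p"
      using cyclic[OF X Y JZ, of p] by simp
    also have "\<dots> = F Z (appJ J X) Y p + F Y Z (appJ J X) p"
      using F_appJ_middle[OF Z X Y] F_appJ_middle[OF Y Z X] by simp
    also have "\<dots> = - F (appJ J X) Y Z p"
      using cyclic[OF JX Y Z, of p] by simp
    finally show ?thesis .
  qed
  have "nablaJ Dt J X Y p f = - nablaJ D J (appJ J X) (appJ J Y) p f"
    if X: "X \<in> vector_fields A" and Y: "Y \<in> vector_fields A" for X Y p f
  proof -
    note JX = appJ_vector_field[OF X] and JY = appJ_vector_field[OF Y]
    note V = tilde.nablaJ_vector_field[OF X Y] and V' = nablaJ_vector_field[OF JX JY]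
    \<comment> \<open>The sum that has to vanish. The coefficients 1 are kept so that
      \<open>lincomb_vector_field\<close> and \<open>tilde.g_lincomb\<close> apply
      literally.\<close>
    let ?W = "\<lambda>p f. 1 * nablaJ Dt J X Y p f + 1 * nablaJ D J (appJ J X) (appJ J Y) p f"
    have "gt p (?W p) (Z p) = 0" if Z: "Z \<in> vector_fields A" for Z
    proof -
      note JZ = appJ_vector_field[OF Z]
      \<comment> \<open>Pairing with \<open>Z\<close> in \<open>gt\<close> is pairing with
        \<open>JZ\<close> in \<open>g\<close>, which is why \<open>F\<close> appears with three
        \<open>J\<close>s; the last two cancel to a plus sign, opposite to the first
        identity.\<close>
      have "F (appJ J X) (appJ J Y) (appJ J Z) p = - F (appJ J X) Y (appJ J (appJ J Z)) p"
        by (rule F_appJ_middle[OF JX Y JZ])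
      also have "\<dots> = F (appJ J X) Y Z p"
        using g_appJ_appJ[OF nablaJ_vector_field[OF JX Y] Z, of p]
          g_appJ_left[OF nablaJ_vector_field[OF JX Y] JZ, of p] by (simp add: F_tensor_def)
      finally have "gt p (nablaJ D J (appJ J X) (appJ J Y) p) (Z p) = F (appJ J X) Y Z p"
        by (simp add: F_tensor_def gt_eq)
      then show ?thesis
        using tilde.g_lincomb[OF V V' Z, of p 1 1] F[OF X Y Z, of p] by (simp add: F_tensor_def)
    qed
    then have "?W p = (\<lambda>f. 0)"
      by (rule metric_nondegenerate_on_vector_fields[where W = ?W, OF tilde.metric lincomb_vector_field[OF V V']])
    from fun_cong[OF this, of f] show ?thesis by simp
  qed
  with F show ?thesis by blast
qed

end
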